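(* Consider the pendulum swing-up optimal control problem with optimal value function $$J^*(x_0)=\min_{u(\cdot)}\int_0^{+\infty} c(x(t),u(t))\,dt\quad\text{subject to } x(0)=x_0,\ u(t)\in\mathbb{U},\ \dot x(t)=f(x(t),u(t)),$$ where the minimum is over admissible controls and $f$, $c$, $\mathbb{U}$ are the pendulum dynamics, running cost and control set. Then $J^*$ is not $C^1$ at the bottomright position $x_{\mathrm{B}}=[\pi+2k\pi,\,0]^{\mathsf T}$, for every $k\in\mathbb{Z}$.
   Context: State: $x=[\theta,\dot\theta]^{\mathsf T}\in\mathbb{R}^2$ (with $\theta\in\mathbb{R}$ not reduced modulo $2\pi$). Dynamics: $$\dot x=f(x,u)=\begin{bmatrix}\dot\theta\\ -\frac{1}{ml^2}\left(b\dot\theta-mgl\sin\theta-u\right)\end{bmatrix},$$ where $m>0$ is the mass, $l>0$ the pole length, $b\ge 0$ the damping coefficient, $g>0$ the gravity constant, and $u\in\mathbb{R}$ the torque. Running cost: $c(x,u)=q_1\sin^2\theta+q_1(\cos\theta-1)^2+q_2\dot\theta^2+ru^2$ with $q_1,q_2,r>0$. Control set: $\mathbb{U}$ is either $\mathbb{R}$ or $[-u_{\max},u_{\max}]$ with $0<u_{\max}<mgl$. Upright positions: $x_{\mathrm U}=[2k\pi,0]^{\mathsf T}$, $k\in\mathbb{Z}$. Admissible controls (standing assumption): a control $u(t)$ with values in $\mathbb{U}$ is admissible if (i) it is piecewise continuous, and (ii) the resulting state trajectory satisfies $x(t)\to x_{\mathrm U}$ (one of the upright positions) as $t\to+\infty$.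 "$C^1$ at a point" means continuously differentiable on some neighborhood of that point. *)

theory Defs
  imports "HOL-Analysis.Analysis"
begin

definition dynamics :: "real \<Rightarrow> real \<Rightarrow> real \<Rightarrow> real \<Rightarrow> real \<times> real \<Rightarrow> real \<Rightarrow> real \<times> real" where
  "dynamics m l b g = (\<lambda>(\<theta>, \<omega>) u.
     (\<omega>, - (1 / (m * l\<^sup>2)) * (b * \<omega> - m * g * l * sin \<theta> - u)))"

definition running_cost :: "real \<Rightarrow> real \<Rightarrow> real \<Rightarrow> real \<times> real \<Rightarrow> real \<Rightarrow> real" where
  "running_cost q1 q2 r = (\<lambda>(\<theta>, \<omega>) u.
     q1 * (sin \<theta>)\<^sup>2 + q1 * (cos \<theta> - 1)\<^sup>2 + q2 * \<omega>\<^sup>2 + r * u\<^sup>2)"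

definition upright :: "int \<Rightarrow> real \<times> real" where
  "upright k = (2 * of_int k * pi, 0)"

definition bottomright :: "int \<Rightarrow> real \<times> real" where
  "bottomright k = (pi + 2 * of_int k * pi, 0)"

text \<open>Controls are total functions on the reals, but only their values on the half-line
  \<open>{0..}\<close> are ever used. Piecewise continuity is the usual one on an unbounded interval: finitely
  many discontinuities in each bounded interval, all with finite one-sided limits.\<close>

definition piecewise_continuous :: "(real \<Rightarrow> real) \<Rightarrow> bool" where
  "piecewise_continuous u \<longleftrightarrow>
     (\<forall>T. finite {t \<in> {0..T}. \<not> continuous (at t within {0..}) u}) \<and>
     (\<forall>t\<ge>0. \<exists>L. (u \<longlongrightarrow> L) (at_right t)) \<and>
     (\<forall>t>0. \<exists>L. (u \<longlongrightarrow> L) (at_left t))"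

text \<open>The differential equation is imposed where the control is continuous; at a jump of \<open>u\<close>
  the state is only required to be continuous.\<close>

definition trajectory ::
  "(real \<times> real \<Rightarrow> real \<Rightarrow> real \<times> real) \<Rightarrow> real \<times> real \<Rightarrow> (real \<Rightarrow> real) \<Rightarrow> (real \<Rightarrow> real \<times> real) \<Rightarrow> bool"
where
  "trajectory f x0 u x \<longleftrightarrow>
     x 0 = x0 \<and> continuous_on {0..} x \<and>
     (\<forall>t\<ge>0. continuous (at t within {0..}) u \<longrightarrow>
        (x has_vector_derivative f (x t) (u t)) (at t within {0..}))"

definition admissible ::
  "(real \<times> real \<Rightarrow> real \<Rightarrow> real \<times> real) \<Rightarrow> real set \<Rightarrow> real \<times> real \<Rightarrow> (real \<Rightarrow> real) \<Rightarrow> (real \<Rightarrow> real \<times> real) \<Rightarrow> bool"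
where
  "admissible f U x0 u x \<longleftrightarrow>
     (\<forall>t\<ge>0. u t \<in> U) \<and> piecewise_continuous u \<and> trajectory f x0 u x \<and>
     (\<exists>k. (x \<longlongrightarrow> upright k) at_top)"

definition total_cost ::
  "(real \<times> real \<Rightarrow> real \<Rightarrow> real) \<Rightarrow> (real \<Rightarrow> real) \<Rightarrow> (real \<Rightarrow> real \<times> real) \<Rightarrow> ennreal"
where
  "total_cost c u x = (\<integral>\<^sup>+ t\<in>{0..}. ennreal (c (x t) (u t)) \<partial>lborel)"

text \<open>The total cost of an admissible control may be infinite, so the optimal value is formed in
  the extended nonnegative reals. The infimum is the minimum whenever the latter is attained, and
  it is \<open>\<infinity>\<close> if there is no admissible control of finite cost.\<close>

definition optimal_value ::
  "(real \<times> real \<Rightarrow> real \<Rightarrow> real \<times> real) \<Rightarrow> (real \<times> real \<Rightarrow> real \<Rightarrow> real) \<Rightarrow> real set \<Rightarrow> real \<times> real \<Rightarrow> ennreal"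
where
  "optimal_value f c U x0 = (INF (u, x) \<in> {(u, x). admissible f U x0 u x}. total_cost c u x)"

text \<open>For an extended-valued function, being \<open>C\<^sup>1\<close> at a point includes being finite nearby; this
  prevents the junk value \<open>enn2real \<infinity> = 0\<close> from playing any role.\<close>

definition C1_at :: "('a::real_normed_vector \<Rightarrow> ennreal) \<Rightarrow> 'a \<Rightarrow> bool" where
  "C1_at J a \<longleftrightarrow>
     (\<exists>N. open N \<and> a \<in> N \<and> (\<forall>x\<in>N. J x < \<infinity>) \<and>
        (\<exists>J' :: 'a \<Rightarrow> 'a \<Rightarrow>\<^sub>L real.
           (\<forall>x\<in>N. ((\<lambda>y. enn2real (J y)) has_derivative blinfun_apply (J' x)) (at x)) \<and>
           continuous_on N J'))"

end

theory Submission
  imports Defs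
begin

text \<open>
  The pendulum is symmetric about the bottom position \<open>a\<close>: reflecting the state in \<open>a\<close> and
  negating the torque maps trajectories to trajectories, permutes the upright positions and keeps
  the cost. So the value function \<open>V\<close> is even about \<open>a\<close>, and if it is differentiable there, its
  derivative at \<open>a\<close> vanishes. The Hamilton--Jacobi--Bellman equation at \<open>a\<close> would then read
  \<open>0 = min\<^sub>u c(a, u)\<close>, but this minimum is \<open>4 q\<^sub>1 > 0\<close>.

  The contradiction is reached without proving the Hamilton--Jacobi--Bellman equation, by a
  comparison along a single trajectory. Near \<open>a\<close> the state cost is bounded away from 0 and the
  control cost is quadratic, while the speed grows only linearly in the control; hence
  \<open>\<mu> |f(z, v)| \<le> c(z, v)\<close> for some \<open>\<mu> > 0\<close>, all controls \<open>v\<close> and all \<open>z\<close> near \<open>a\<close>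
  (\<open>pendulum_cost_dominates_speed\<close>). Every admissible trajectory from \<open>a\<close> must reach each small
  sphere of radius \<open>\<rho>\<close> around \<open>a\<close>, since it tends to an upright position. By the time \<open>\<tau>\<close> at which
  it first does so, it has paid at least \<open>\<mu> \<rho>\<close> (\<open>displacement_le_cost\<close>), and what
  remains costs at least \<open>V (x \<tau>)\<close> (\<open>optimal_value_le_cost_to_go\<close>). Choosing the trajectory nearly
  optimal shows that \<open>V\<close> drops by more than \<open>\<mu> \<rho> / 2\<close> over the distance \<open>\<rho>\<close>, which a zero derivative
  forbids once \<open>\<rho>\<close> is small (\<open>value_not_flat_where_cost_dominates_speed\<close>). Measuring progress by
  distance rather than by time is what makes the unbounded control set as easy as the bounded one.
\<close>

section \<open>Restarting an admissible control\<close>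

lemma at_within_atLeast_right: "at a within {a..} = at_right (a::real)"
proof -
  have "{a..} - {a} = {a<..} - {a}" by auto
  then show ?thesis by (simp add: at_within_def)
qed

lemma at_within_atLeast_interior:
  fixes t :: real
  assumes "0 < t"
  shows "at t within {0..} = at t"
  using assms by (intro at_within_interior interiorI[of "{0<..}"]) auto

lemma countable_discontinuities:
  assumes "piecewise_continuous u"
  shows "countable {t. 0 \<le> t \<and> \<not> continuous (at t within {0..}) u}"
proof -
  have "{t. 0 \<le> t \<and> \<not> continuous (at t within {0..}) u} =
      (\<Union>n::nat. {t \<in> {0..real n}. \<not> continuous (at t within {0..}) u})"
    using real_arch_simple by auto
  also have "countable \<dots>"
    using assms unfolding piecewise_continuous_def
    by (auto intro!: countable_UN intro: countable_finite)
  finally show ?thesis .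
qed

lemma continuous_shifted_iff:
  fixes u :: "real \<Rightarrow> 'a::topological_space"
  assumes "0 \<le> \<tau>" "0 < t" and eq: "\<And>s. 0 < s \<Longrightarrow> w s = u (s + \<tau>)"
  shows "continuous (at t within {0..}) w \<longleftrightarrow> continuous (at (t + \<tau>) within {0..}) u"
proof -
  have "eventually (\<lambda>s. w s = u (s + \<tau>)) (nhds t)"
    using eventually_nhds_in_open[of "{0<..}" t] assms
    by (auto elim!: eventually_mono intro: eq)
  then have "isCont w t \<longleftrightarrow> isCont (\<lambda>s. u (s + \<tau>)) t"
    by (rule isCont_cong)
  also have "\<dots> \<longleftrightarrow> isCont u (t + \<tau>)"
  proof
    assume "isCont (\<lambda>s. u (s + \<tau>)) t"
    then have "isCont (\<lambda>s. u ((s - \<tau>) + \<tau>)) (t + \<tau>)"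
      by (intro isCont_o2[where f = "\<lambda>s. s - \<tau>" and g = "\<lambda>s. u (s + \<tau>)"]) auto
    then show "isCont u (t + \<tau>)" by simp
  next
    assume "isCont u (t + \<tau>)"
    then show "isCont (\<lambda>s. u (s + \<tau>)) t"
      by (intro isCont_o2[where f = "\<lambda>s. s + \<tau>" and g = u]) auto
  qed
  finally show ?thesis
    using assms by (simp add: at_within_atLeast_interior)
qed

lemma piecewise_continuous_shift:
  assumes pc: "piecewise_continuous u" and "0 \<le> \<tau>"
    and eq: "\<And>s. 0 < s \<Longrightarrow> w s = u (s + \<tau>)"
  shows "piecewise_continuous w"
  unfolding piecewise_continuous_def
proof (intro conjI allI impI)
  fix T
  let ?D = "{t \<in> {0..T + \<tau>}. \<not> continuous (at t within {0..}) u}"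
  have "{t \<in> {0..T}. \<not> continuous (at t within {0..}) w} \<subseteq> insert 0 ((\<lambda>s. s - \<tau>) ` ?D)"
  proof
    fix t assume t: "t \<in> {t \<in> {0..T}. \<not> continuous (at t within {0..}) w}"
    show "t \<in> insert 0 ((\<lambda>s. s - \<tau>) ` ?D)"
    proof (cases "t = 0")
      case False
      with t continuous_shifted_iff[where w = w and u = u and t = t, OF \<open>0 \<le> \<tau>\<close> _ eq] have "t + \<tau> \<in> ?D"
        using \<open>0 \<le> \<tau>\<close> by auto
      then show ?thesis by (intro insertI2 image_eqI[where x = "t + \<tau>"]) auto
    qed simp
  qed
  moreover have "finite ?D" using pc by (simp add: piecewise_continuous_def)
  ultimately show "finite {t \<in> {0..T}. \<not> continuous (at t within {0..}) w}"
    by (meson finite_subset finite_insert finite_imageI)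
next
  fix t :: real assume "0 \<le> t"
  then obtain L where L: "(u \<longlongrightarrow> L) (at_right (t + \<tau>))"
    using pc \<open>0 \<le> \<tau>\<close> unfolding piecewise_continuous_def by (meson add_nonneg_nonneg)
  have "filterlim (\<lambda>s. s + \<tau>) (at_right (t + \<tau>)) (at_right t)"
    unfolding filterlim_at
    by (auto intro!: tendsto_intros eventually_at_rightI[of t "t + 1"])
  from filterlim_compose[OF L this] have "((\<lambda>s. u (s + \<tau>)) \<longlongrightarrow> L) (at_right t)" .
  moreover have "eventually (\<lambda>s. u (s + \<tau>) = w s) (at_right t)"
    using eventually_at_right_less[of t] by eventually_elim (use \<open>0 \<le> t\<close> eq in auto)
  ultimately show "\<exists>L. (w \<longlongrightarrow> L) (at_right t)"
    by (blast intro: Lim_transform_eventually)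
next
  fix t :: real assume "0 < t"
  then obtain L where L: "(u \<longlongrightarrow> L) (at_left (t + \<tau>))"
    using pc \<open>0 \<le> \<tau>\<close> unfolding piecewise_continuous_def by (meson add_pos_nonneg)
  have "filterlim (\<lambda>s. s + \<tau>) (at_left (t + \<tau>)) (at_left t)"
    unfolding filterlim_at
    by (auto intro!: tendsto_intros eventually_at_leftI[of "t - 1" t])
  from filterlim_compose[OF L this] have "((\<lambda>s. u (s + \<tau>)) \<longlongrightarrow> L) (at_left t)" .
  moreover have "eventually (\<lambda>s. u (s + \<tau>) = w s) (at_left t)"
    using eventually_at_left_real[OF \<open>0 < t\<close>] by eventually_elim (use eq in auto)
  ultimately show "\<exists>L. (w \<longlongrightarrow> L) (at_left t)"
    by (blast intro: Lim_transform_eventually)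
qed

text \<open>If the control jumps at \<open>\<tau>\<close> but takes its right-hand limit there, its tail after \<open>\<tau>\<close> is
  continuous on the half-line at its starting time. The tail would then have to satisfy the
  differential equation from the right at \<open>\<tau>\<close>, which the original trajectory is not required to. The value
  of the tail at its starting time is therefore replaced by one that differs from the right-hand
  limit: the new control jumps at time 0, so only continuity of the state is demanded there.\<close>

lemma admissible_restart:
  assumes adm: "admissible f U x0 u x" and "0 \<le> \<tau>" and two: "\<And>L. \<exists>v\<in>U. v \<noteq> L"
  obtains w where "admissible f U (x \<tau>) w (\<lambda>t. x (t + \<tau>))"
    and "\<And>t. 0 < t \<Longrightarrow> w t = u (t + \<tau>)"
proof -
  have U: "u t \<in> U" if "0 \<le> t" for t using adm that by (auto simp: admissible_def)
  have pc: "piecewise_continuous u" using adm by (simp add: admissible_def)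
  have cx: "continuous_on {0..} x"
    and ode: "\<And>t. 0 \<le> t \<Longrightarrow> continuous (at t within {0..}) u \<Longrightarrow>
        (x has_vector_derivative f (x t) (u t)) (at t within {0..})"
    using adm by (auto simp: admissible_def trajectory_def)
  obtain j where j: "(x \<longlongrightarrow> upright j) at_top" using adm by (auto simp: admissible_def)
  obtain L where L: "(u \<longlongrightarrow> L) (at_right \<tau>)"
    using pc \<open>0 \<le> \<tau>\<close> by (auto simp: piecewise_continuous_def)
  obtain v where v: "v \<in> U" "v \<noteq> L" using two by blast
  define w where "w = (\<lambda>t. if t = 0 then v else u (t + \<tau>))"
  have w: "w t = u (t + \<tau>)" if "0 < t" for t using that by (simp add: w_def)
  have jump: "\<not> continuous (at 0 within {0..}) w"
  proof
    assume "continuous (at 0 within {0..}) w"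
    then have "(w \<longlongrightarrow> v) (at_right 0)"
      by (simp add: continuous_within at_within_atLeast_right w_def)
    moreover have "(w \<longlongrightarrow> L) (at_right 0)"
    proof -
      have "filterlim (\<lambda>s. s + \<tau>) (at_right \<tau>) (at_right 0)"
        unfolding filterlim_at
        by (auto intro!: tendsto_eq_intros eventually_at_rightI[of 0 1])
      from filterlim_compose[OF L this] have "((\<lambda>s. u (s + \<tau>)) \<longlongrightarrow> L) (at_right 0)" .
      moreover have "eventually (\<lambda>s. u (s + \<tau>) = w s) (at_right 0)"
        using eventually_at_right_less[of 0] by eventually_elim (simp add: w)
      ultimately show ?thesis by (rule Lim_transform_eventually)
    qed
    ultimately show False
      using v tendsto_unique trivial_limit_at_right_real by blast
  qed
  have "trajectory f (x \<tau>) w (\<lambda>t. x (t + \<tau>))"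
    unfolding trajectory_def
  proof (intro conjI allI impI)
    show "continuous_on {0..} (\<lambda>t. x (t + \<tau>))"
      by (rule continuous_on_compose2[OF cx]) (auto intro!: continuous_intros simp: \<open>0 \<le> \<tau>\<close>)
  next
    fix t :: real assume "0 \<le> t" and ct: "continuous (at t within {0..}) w"
    then have "0 < t" using jump by (cases "t = 0") auto
    with ct have "continuous (at (t + \<tau>) within {0..}) u"
      using continuous_shifted_iff[where w = w and u = u and t = t, OF \<open>0 \<le> \<tau>\<close> _ w] by simp
    then have "(x has_vector_derivative f (x (t + \<tau>)) (u (t + \<tau>))) (at (t + \<tau>))"
      using ode[of "t + \<tau>"] \<open>0 < t\<close> \<open>0 \<le> \<tau>\<close> by (simp add: at_within_atLeast_interior)
    moreover have "((\<lambda>s. s + \<tau>) has_vector_derivative 1) (at t)"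
      by (auto intro!: derivative_eq_intros)
    ultimately have "(x \<circ> (\<lambda>s. s + \<tau>) has_vector_derivative f (x (t + \<tau>)) (u (t + \<tau>))) (at t)"
      using vector_diff_chain_at[of "\<lambda>s. s + \<tau>" 1 t x] by simp
    then show "((\<lambda>t. x (t + \<tau>)) has_vector_derivative f (x (t + \<tau>)) (w t)) (at t within {0..})"
      using \<open>0 < t\<close> by (simp add: o_def w has_vector_derivative_at_within)
  qed simp
  moreover have "((\<lambda>t. x (t + \<tau>)) \<longlongrightarrow> upright j) at_top"
    by (rule filterlim_compose[OF j])
       (simp add: filterlim_tendsto_add_at_top[OF tendsto_const filterlim_ident] flip: add.commute[of \<tau>])
  moreover have "\<forall>t\<ge>0. w t \<in> U" using v(1) U \<open>0 \<le> \<tau>\<close> by (auto simp: w_def)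
  moreover have "piecewise_continuous w" by (rule piecewise_continuous_shift[OF pc \<open>0 \<le> \<tau>\<close> w])
  ultimately have "admissible f U (x \<tau>) w (\<lambda>t. x (t + \<tau>))"
    unfolding admissible_def by blast
  then show thesis using w that by blast
qed

section \<open>Costs along a trajectory\<close>

lemma borel_measurable_cost:
  fixes c :: "real \<times> real \<Rightarrow> real \<Rightarrow> real"
  assumes pc: "piecewise_continuous u" and cx: "continuous_on {0..} x"
    and cc: "continuous_on UNIV (\<lambda>(z, v). c z v)"
  shows "(\<lambda>t. indicator {0..} t * c (x t) (u t)) \<in> borel_measurable borel"
proof (rule borel_measurable_continuous_countable_exceptions)
  let ?X = "insert 0 {t. 0 \<le> t \<and> \<not> continuous (at t within {0..}) u}"
  show "countable ?X" using countable_discontinuities[OF pc] by simp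
  show "continuous_on (- ?X) (\<lambda>t. indicator {0..} t * c (x t) (u t))"
  proof (rule continuous_at_imp_continuous_on, rule ballI)
    fix t assume t: "t \<in> - ?X"
    show "isCont (\<lambda>t. indicator {0..} t * c (x t) (u t)) t"
    proof (cases "t < 0")
      case True
      have "eventually (\<lambda>s. indicator {0..} s * c (x s) (u s) = 0) (nhds t)"
        using eventually_nhds_in_open[of "{..<0}" t] True
        by (auto elim!: eventually_mono)
      from isCont_cong[OF this] show ?thesis by simp
    next
      case False
      with t have "0 < t" by auto
      then have "isCont u t" "isCont x t"
        using t cx by (auto simp: at_within_atLeast_interior continuous_on_eq_continuous_within
            dest!: bspec[of _ _ t])
      moreover have "isCont (\<lambda>(z, v). c z v) (x t, u t)"
        using cc unfolding continuous_on_eq_continuous_at[OF open_UNIV] by blast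
      ultimately have "isCont (\<lambda>s. (\<lambda>(z, v). c z v) (x s, u s)) t"
        by (intro isCont_o2[where f = "\<lambda>s. (x s, u s)" and g = "\<lambda>(z, v). c z v"] isCont_Pair)
      moreover have "eventually (\<lambda>s. indicator {0..} s * c (x s) (u s) = c (x s) (u s)) (nhds t)"
        using eventually_nhds_in_open[of "{0<..}" t] \<open>0 < t\<close>
        by (auto elim!: eventually_mono)
      from isCont_cong[OF this] calculation show ?thesis by simp
    qed
  qed
qed

text \<open>This is the half of the dynamic programming principle that says that the tail of a control
  cannot beat the optimum from the state where it starts. The value of the restarted control at
  time 0 does not affect its cost.\<close>

lemma optimal_value_le_cost_to_go:
  assumes adm: "admissible f U x0 u x" and "0 \<le> \<tau>" and two: "\<And>L. \<exists>v\<in>U. v \<noteq> L"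
    and cc: "continuous_on UNIV (\<lambda>(z, v). c z v)"
  shows "(\<integral>\<^sup>+ t\<in>{0..\<tau>}. ennreal (c (x t) (u t)) \<partial>lborel) + optimal_value f c U (x \<tau>)
         \<le> total_cost c u x"
proof -
  obtain w where w: "admissible f U (x \<tau>) w (\<lambda>t. x (t + \<tau>))" "\<And>t. 0 < t \<Longrightarrow> w t = u (t + \<tau>)"
    using admissible_restart[OF adm \<open>0 \<le> \<tau>\<close> two] by blast
  define F where "F = (\<lambda>t. ennreal (indicator {0..} t * c (x t) (u t)))"
  have [measurable]: "F \<in> borel_measurable borel"
    unfolding F_def
    by (rule measurable_compose[OF borel_measurable_cost[OF _ _ cc] measurable_ennreal])
      (use adm in \<open>auto simp: admissible_def trajectory_def\<close>)
  have "optimal_value f c U (x \<tau>) \<le> total_cost c w (\<lambda>t. x (t + \<tau>))"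
    unfolding optimal_value_def using w(1)
    by (intro INF_lower2[where i = "(w, \<lambda>t. x (t + \<tau>))"]) auto
  also have "\<dots> = (\<integral>\<^sup>+ t. F (\<tau> + 1 * t) * indicator {\<tau><..} (\<tau> + 1 * t) \<partial>lborel)"
    unfolding total_cost_def
  proof (rule nn_integral_cong_AE)
    have "AE t in lborel. t \<noteq> (0::real)" by (rule AE_lborel_singleton)
    then show "AE t in lborel. ennreal (c (x (t + \<tau>)) (w t)) * indicator {0..} t =
        F (\<tau> + 1 * t) * indicator {\<tau><..} (\<tau> + 1 * t)"
      by eventually_elim (use \<open>0 \<le> \<tau>\<close> in \<open>auto simp: F_def w(2) add.commute indicator_def\<close>)
  qed
  also have "\<dots> = (\<integral>\<^sup>+ t\<in>{\<tau><..}. F t \<partial>lborel)"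
    by (subst nn_integral_real_affine[where c = 1 and t = \<tau>]) auto
  finally have tail: "optimal_value f c U (x \<tau>) \<le> (\<integral>\<^sup>+ t\<in>{\<tau><..}. F t \<partial>lborel)" .
  have "(\<integral>\<^sup>+ t\<in>{0..\<tau>}. ennreal (c (x t) (u t)) \<partial>lborel) = (\<integral>\<^sup>+ t\<in>{0..\<tau>}. F t \<partial>lborel)"
    by (intro nn_integral_cong) (auto simp: F_def indicator_def)
  moreover have "total_cost c u x = (\<integral>\<^sup>+ t\<in>{0..\<tau>} \<union> {\<tau><..}. F t \<partial>lborel)"
    unfolding total_cost_def using \<open>0 \<le> \<tau>\<close>
    by (intro nn_integral_cong) (auto simp: F_def indicator_def)
  moreover have "(\<integral>\<^sup>+ t\<in>{0..\<tau>} \<union> {\<tau><..}. F t \<partial>lborel) =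
      (\<integral>\<^sup>+ t\<in>{0..\<tau>}. F t \<partial>lborel) + (\<integral>\<^sup>+ t\<in>{\<tau><..}. F t \<partial>lborel)"
    by (rule nn_integral_disjoint_pair) auto
  ultimately show ?thesis using tail by (simp add: add_left_mono)
qed

text \<open>The distance covered is the integral of the component of the velocity along the chord from
  start to end, and that component is at most the speed. Projecting onto the chord reduces the
  claim to a comparison of two scalar integrals. The velocity is integrated in the sense of
  Henstock and Kurzweil, where the fundamental theorem of calculus asks for neither boundedness
  nor measurability of the derivative and tolerates the finitely many jumps of the control.\<close>

lemma displacement_le_cost:
  assumes tr: "trajectory f x0 u x" and pc: "piecewise_continuous u" and "0 \<le> \<tau>" "0 \<le> \<mu>"
    and cc: "continuous_on UNIV (\<lambda>(z, v). c z v)"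
    and dom: "\<And>t. t \<in> {0..\<tau>} \<Longrightarrow> \<mu> * norm (f (x t) (u t)) \<le> c (x t) (u t)"
  shows "ennreal (\<mu> * dist (x \<tau>) (x 0)) \<le> (\<integral>\<^sup>+ t\<in>{0..\<tau>}. ennreal (c (x t) (u t)) \<partial>lborel)"
proof -
  define h where "h = (\<lambda>t. indicator {0..\<tau>} t * (indicator {0..} t * c (x t) (u t)))"
  have cx: "continuous_on {0..} x" using tr by (simp add: trajectory_def)
  have hm: "h \<in> borel_measurable borel"
    unfolding h_def using borel_measurable_cost[OF pc cx cc] by measurable
  have h0: "0 \<le> h t" for t
    using dom[of t] \<open>0 \<le> \<mu>\<close> by (auto simp: h_def indicator_def intro: order_trans[rotated])
  have eq: "(\<integral>\<^sup>+ t\<in>{0..\<tau>}. ennreal (c (x t) (u t)) \<partial>lborel) = (\<integral>\<^sup>+ t. ennreal (h t) \<partial>lborel)"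
    by (intro nn_integral_cong) (auto simp: h_def indicator_def)
  \<comment> \<open>Only a cost of finite integral can be read as a Henstock--Kurzweil integral.\<close>
  show ?thesis
  proof (cases "(\<integral>\<^sup>+ t. ennreal (h t) \<partial>lborel) < \<infinity>")
    case False
    then have "(\<integral>\<^sup>+ t. ennreal (h t) \<partial>lborel) = \<infinity>" by (simp flip: less_top)
    then show ?thesis by (simp add: eq)
  next
    case True
    then obtain I where I: "(h has_integral I) UNIV"
      using nn_integral_integrable_on[OF hm h0] by blast
    then have hI: "(\<integral>\<^sup>+ t. ennreal (h t) \<partial>lborel) = ennreal I"
      using nn_integral_has_integral_lborel[OF hm h0] by blast
    have cI: "((\<lambda>t. c (x t) (u t)) has_integral I) {0..\<tau>}"
      using I by (subst has_integral_restrict_UNIV[symmetric])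
        (auto simp: h_def indicator_def elim!: has_integral_eq[rotated])
    define a where "a = \<mu> *\<^sub>R sgn (x \<tau> - x 0)"
    have na: "norm a \<le> \<mu>" using \<open>0 \<le> \<mu>\<close> by (simp add: a_def norm_sgn)
    have "((\<lambda>t. a \<bullet> f (x t) (u t)) has_integral (a \<bullet> x \<tau> - a \<bullet> x 0)) {0..\<tau>}"
    proof (rule fundamental_theorem_of_calculus_interior_strong)
      show "finite {t \<in> {0..\<tau>}. \<not> continuous (at t within {0..}) u}"
        using pc by (simp add: piecewise_continuous_def)
      show "continuous_on {0..\<tau>} (\<lambda>t. a \<bullet> x t)"
        by (intro continuous_intros continuous_on_subset[OF cx]) auto
      fix t assume t: "t \<in> {0<..<\<tau>} - {t \<in> {0..\<tau>}. \<not> continuous (at t within {0..}) u}"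
      then have "(x has_vector_derivative f (x t) (u t)) (at t)"
        using tr by (auto simp: trajectory_def at_within_atLeast_interior dest!: spec[of _ t])
      then show "((\<lambda>t. a \<bullet> x t) has_vector_derivative a \<bullet> f (x t) (u t)) (at t)"
        by (rule bounded_linear.has_vector_derivative[OF bounded_linear_inner_right])
    qed fact
    then have "a \<bullet> x \<tau> - a \<bullet> x 0 \<le> I"
    proof (rule has_integral_le[OF _ cI])
      fix t assume t: "t \<in> {0..\<tau>}"
      have "a \<bullet> f (x t) (u t) \<le> norm a * norm (f (x t) (u t))" by (rule norm_cauchy_schwarz)
      also have "\<dots> \<le> \<mu> * norm (f (x t) (u t))" using na by (rule mult_right_mono) simp
      also have "\<dots> \<le> c (x t) (u t)" by (rule dom[OF t])
      finally show "a \<bullet> f (x t) (u t) \<le> c (x t) (u t)" .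
    qed
    moreover have "a \<bullet> x \<tau> - a \<bullet> x 0 = \<mu> * dist (x \<tau>) (x 0)"
    proof -
      have "sgn y \<bullet> y = norm y" for y :: "real \<times> real"
        by (cases "y = 0")
          (simp_all add: sgn_div_norm power2_eq_square flip: power2_norm_eq_inner)
      moreover have "a \<bullet> x \<tau> - a \<bullet> x 0 = \<mu> * (sgn (x \<tau> - x 0) \<bullet> (x \<tau> - x 0))"
        by (simp add: a_def inner_diff_right right_diff_distrib)
      ultimately show ?thesis by (simp add: dist_norm)
    qed
    ultimately show ?thesis by (simp add: eq hI ennreal_leI)
  qed
qed

lemma first_hitting_time:
  fixes h :: "real \<Rightarrow> real"
  assumes ch: "continuous_on {0..} h" and "h 0 \<le> \<rho>" "0 \<le> T" "\<rho> \<le> h T"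
  obtains \<tau> where "0 \<le> \<tau>" "h \<tau> = \<rho>" "\<And>t. t \<in> {0..\<tau>} \<Longrightarrow> h t \<le> \<rho>"
proof -
  have hit: "\<exists>s. 0 \<le> s \<and> s \<le> t \<and> h s = \<rho>" if "0 \<le> t" "\<rho> \<le> h t" for t
    using IVT'[of h 0 \<rho> t] that \<open>h 0 \<le> \<rho>\<close> continuous_on_subset[OF ch, of "{0..t}"] by auto
  define S where "S = {t \<in> {0..}. h t = \<rho>}"
  have "S \<noteq> {}" using hit[OF \<open>0 \<le> T\<close> \<open>\<rho> \<le> h T\<close>] by (auto simp: S_def)
  moreover have bdd: "bdd_below S" by (auto simp: S_def intro!: bdd_belowI[of _ 0])
  moreover have "closed S"
    unfolding S_def by (intro continuous_closed_preimage_constant ch) auto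
  ultimately have "Inf S \<in> S" by (rule closed_contains_Inf)
  moreover have "h t \<le> \<rho>" if t: "t \<in> {0..Inf S}" for t
  proof (rule ccontr)
    assume "\<not> h t \<le> \<rho>"
    then obtain s where s: "0 \<le> s" "s \<le> t" "h s = \<rho>" using hit[of t] t by auto
    then have "Inf S \<le> s" using bdd by (intro cInf_lower) (auto simp: S_def)
    with s t have "s = t" by simp
    with s \<open>\<not> h t \<le> \<rho>\<close> show False by simp
  qed
  ultimately show thesis using that[of "Inf S"] by (auto simp: S_def)
qed

section \<open>Point symmetry of the value function\<close>

lemma admissible_reflect:
  assumes adm: "admissible f U x0 u x"
    and f: "\<And>z v. f (2 *\<^sub>R a - z) (- v) = - f z v"
    and U: "\<And>v. v \<in> U \<Longrightarrow> - v \<in> U"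
    and up: "\<And>j. \<exists>i. 2 *\<^sub>R a - upright j = upright i"
  shows "admissible f U (2 *\<^sub>R a - x0) (\<lambda>t. - u t) (\<lambda>t. 2 *\<^sub>R a - x t)"
proof -
  have cont: "continuous F (\<lambda>t. - u t) \<longleftrightarrow> continuous F u" for F
    using continuous_minus[of F u] continuous_minus[of F "\<lambda>t. - u t"] by auto
  have "piecewise_continuous (\<lambda>t. - u t)"
    using adm unfolding admissible_def piecewise_continuous_def cont
    by (blast intro: tendsto_minus)
  moreover have "trajectory f (2 *\<^sub>R a - x0) (\<lambda>t. - u t) (\<lambda>t. 2 *\<^sub>R a - x t)"
    using adm unfolding admissible_def trajectory_def cont f
    by (auto intro!: continuous_intros derivative_eq_intros)
  moreover obtain j where "(x \<longlongrightarrow> upright j) at_top" using adm by (auto simp: admissible_def)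
  then have "((\<lambda>t. 2 *\<^sub>R a - x t) \<longlongrightarrow> 2 *\<^sub>R a - upright j) at_top" by (intro tendsto_intros)
  then have "\<exists>i. ((\<lambda>t. 2 *\<^sub>R a - x t) \<longlongrightarrow> upright i) at_top" using up[of j] by auto
  ultimately show ?thesis using adm U unfolding admissible_def by auto
qed

lemma optimal_value_reflect:
  assumes f: "\<And>z v. f (2 *\<^sub>R a - z) (- v) = - f z v"
    and c: "\<And>z v. c (2 *\<^sub>R a - z) (- v) = c z v"
    and U: "\<And>v. v \<in> U \<Longrightarrow> - v \<in> U"
    and up: "\<And>j. \<exists>i. 2 *\<^sub>R a - upright j = upright i"
  shows "optimal_value f c U (2 *\<^sub>R a - z) = optimal_value f c U z"
proof -
  have le: "optimal_value f c U (2 *\<^sub>R a - y) \<le> optimal_value f c U y" for y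
    unfolding optimal_value_def
  proof (rule INF_mono)
    fix p assume "p \<in> {(u, x). admissible f U y u x}"
    then obtain u x where p: "p = (u, x)" "admissible f U y u x" by auto
    show "\<exists>p'\<in>{(u, x). admissible f U (2 *\<^sub>R a - y) u x}.
        (case p' of (u, x) \<Rightarrow> total_cost c u x) \<le> (case p of (u, x) \<Rightarrow> total_cost c u x)"
      using admissible_reflect[OF p(2) f U up]
      by (intro bexI[where x = "(\<lambda>t. - u t, \<lambda>t. 2 *\<^sub>R a - x t)"]) (auto simp: total_cost_def c p)
  qed
  from le[of z] le[of "2 *\<^sub>R a - z"] show ?thesis by simp
qed

text \<open>Reflection in \<open>a\<close> fixes \<open>a\<close> and acts on tangent vectors by \<open>-1\<close>, so the chain rule makes
  the derivative both odd and invariant.\<close>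

lemma derivative_zero_at_centre_of_symmetry:
  fixes J :: "'a::real_normed_vector \<Rightarrow> 'b::real_normed_vector"
  assumes D: "(J has_derivative D) (at a)" and sym: "\<And>y. J (2 *\<^sub>R a - y) = J y"
  shows "D = (\<lambda>_. 0)"
proof -
  have "2 *\<^sub>R a - a = a" by (simp add: scaleR_2)
  then have "(J has_derivative D) (at (2 *\<^sub>R a - a))" using D by simp
  moreover have "((\<lambda>y. 2 *\<^sub>R a - y) has_derivative (\<lambda>y. - y)) (at a)"
    by (auto intro!: derivative_eq_intros)
  ultimately have "((\<lambda>y. J (2 *\<^sub>R a - y)) has_derivative (\<lambda>y. D (- y))) (at a)"
    using has_derivative_compose by blast
  then have "D = (\<lambda>y. D (- y))"
    using D by (simp add: sym has_derivative_unique)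
  then have "D y = - D y" for y
    using linear_neg[OF has_derivative_linear[OF D], of y] by metis
  then have "2 *\<^sub>R D y = 0" for y
    by (metis add.right_inverse scaleR_2)
  then show ?thesis by (intro ext) simp
qed

section \<open>Leaving a point of positive cost\<close>

text \<open>Suppose the derivative vanishes. A nearly optimal trajectory pays \<open>\<mu> \<rho>\<close> to reach distance \<open>\<rho>\<close>
  from \<open>a\<close>, so \<open>V\<close> has to be smaller there by more than \<open>\<mu> \<rho> / 2\<close>, whereas flatness permits a
  change of at most \<open>\<mu> \<rho> / 2\<close> for small \<open>\<rho>\<close>. Finiteness of \<open>V\<close> near \<open>a\<close> is what lets these
  inequalities between extended reals be subtracted.\<close>

lemma value_not_flat_where_cost_dominates_speed:
  fixes f :: "real \<times> real \<Rightarrow> real \<Rightarrow> real \<times> real"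
  assumes two: "\<And>L. \<exists>v\<in>U. v \<noteq> L"
    and cc: "continuous_on UNIV (\<lambda>(z, v). c z v)"
    and "0 < \<mu>" "0 < R"
    and dom: "\<And>z v. dist z a \<le> R \<Longrightarrow> \<mu> * norm (f z v) \<le> c z v"
    and far: "\<And>j. R < dist (upright j) a"
    and fin: "\<forall>\<^sub>F y in nhds a. optimal_value f c U y < \<infinity>"
  shows "\<not> ((\<lambda>y. enn2real (optimal_value f c U y)) has_derivative (\<lambda>_. 0)) (at a)"
proof
  define V where "V = optimal_value f c U"
  assume "((\<lambda>y. enn2real (optimal_value f c U y)) has_derivative (\<lambda>_. 0)) (at a)"
  then have "\<forall>\<epsilon>>0. \<exists>d>0. \<forall>y. dist y a < d \<longrightarrow>
      \<bar>enn2real (V y) - enn2real (V a)\<bar> \<le> \<epsilon> * dist y a"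
    unfolding has_derivative_at_alt V_def dist_norm diff_zero real_norm_def by (rule conjunct2)
  then obtain d where "0 < d" and d: "\<And>y. dist y a < d \<Longrightarrow>
      \<bar>enn2real (V y) - enn2real (V a)\<bar> \<le> \<mu> / 2 * dist y a"
    using half_gt_zero[OF \<open>0 < \<mu>\<close>] by blast
  obtain e where "0 < e" and e: "\<And>y. dist y a < e \<Longrightarrow> V y < \<infinity>"
    using fin unfolding eventually_nhds_metric V_def by auto
  \<comment> \<open>The sphere must lie strictly inside the balls of radius \<open>d\<close> and \<open>e\<close>, hence the half.\<close>
  define \<rho> where "\<rho> = min R (min d e / 2)"
  have \<rho>: "0 < \<rho>" "\<rho> \<le> R" "\<rho> < d" "\<rho> < e"
    using \<open>0 < R\<close> \<open>0 < d\<close> \<open>0 < e\<close> by (auto simp: \<rho>_def min_def)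
  have Va: "V a < \<infinity>" using e[of a] \<open>0 < e\<close> by simp
  \<comment> \<open>Near-optimality up to \<open>\<mu> \<rho> / 2\<close>, half of the cost of leaving, balances the flatness bound.\<close>
  have "V a < V a + ennreal (\<mu> * \<rho> / 2)"
    using Va \<rho>(1) \<open>0 < \<mu>\<close> by (cases "V a") (auto simp: ennreal_less_iff simp flip: ennreal_plus)
  then obtain u x where adm: "admissible f U a u x"
    and near: "total_cost c u x < V a + ennreal (\<mu> * \<rho> / 2)"
    unfolding V_def optimal_value_def INF_less_iff by auto
  have x0: "x 0 = a" and cx: "continuous_on {0..} x" and pc: "piecewise_continuous u"
    and tr: "trajectory f a u x"
    using adm by (auto simp: admissible_def trajectory_def)
  obtain j where j: "(x \<longlongrightarrow> upright j) at_top" using adm by (auto simp: admissible_def)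
  have "\<forall>\<^sub>F t in at_top. R < dist (x t) a"
    using j far by (intro order_tendstoD(1)[where y = "dist (upright j) a"] tendsto_intros)
  then obtain T where T: "0 \<le> T" "R < dist (x T) a"
    using eventually_happens'[OF trivial_limit_at_top_linorder
        eventually_conj[OF eventually_ge_at_top[of "0::real"]]] by blast
  have "continuous_on {0..} (\<lambda>t. dist (x t) a)" by (intro continuous_intros cx)
  then obtain \<tau> where \<tau>: "0 \<le> \<tau>" "dist (x \<tau>) a = \<rho>"
      "\<And>t. t \<in> {0..\<tau>} \<Longrightarrow> dist (x t) a \<le> \<rho>"
    by (rule first_hitting_time[where \<rho> = \<rho> and T = T]) (use x0 \<rho> T in auto)
  let ?I = "\<integral>\<^sup>+ t\<in>{0..\<tau>}. ennreal (c (x t) (u t)) \<partial>lborel"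
  have "ennreal (\<mu> * dist (x \<tau>) (x 0)) \<le> ?I"
    using \<tau> \<rho> \<open>0 < \<mu>\<close> by (intro displacement_le_cost[OF tr pc _ _ cc] dom) (auto intro: order_trans)
  then have "ennreal (\<mu> * \<rho>) + V (x \<tau>) \<le> ?I + V (x \<tau>)"
    by (simp add: x0 \<tau> add_right_mono)
  also have "\<dots> \<le> total_cost c u x"
    unfolding V_def by (rule optimal_value_le_cost_to_go[OF adm \<tau>(1) two cc])
  also note near
  finally have *: "ennreal (\<mu> * \<rho>) + V (x \<tau>) < V a + ennreal (\<mu> * \<rho> / 2)" .
  have V: "V y = ennreal (enn2real (V y))" if "V y < \<infinity>" for y
    using that by (simp add: less_top)
  have "V (x \<tau>) < \<infinity>" using e \<tau> \<rho> by simp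
  with * V[of a] V[of "x \<tau>"] Va
  have "ennreal (\<mu> * \<rho>) + ennreal (enn2real (V (x \<tau>))) <
      ennreal (enn2real (V a)) + ennreal (\<mu> * \<rho> / 2)" by simp
  then have "\<mu> * \<rho> + enn2real (V (x \<tau>)) < enn2real (V a) + \<mu> * \<rho> / 2"
    using \<open>0 < \<mu>\<close> \<rho>(1) by (simp add: ennreal_less_iff flip: ennreal_plus)
  moreover have "\<bar>enn2real (V (x \<tau>)) - enn2real (V a)\<bar> \<le> \<mu> / 2 * \<rho>"
    using d[of "x \<tau>"] \<tau> \<rho> by simp
  ultimately show False by (simp add: abs_if split: if_splits)
qed

section \<open>The pendulum\<close>

text \<open>Within distance 1 of the bottom the pendulum hangs below the horizontal, because
  \<open>1 < \<pi> / 2\<close>; there \<open>cos \<theta> \<le> 0\<close> and the state cost is at least \<open>q\<^sub>1\<close>. The speed is at most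
  \<open>A + K |v|\<close>, and \<open>|v| \<le> 1 + v\<^sup>2\<close> lets the constant part be charged to \<open>q\<^sub>1\<close> and the
  quadratic part to \<open>r v\<^sup>2\<close>.\<close>

lemma pendulum_cost_dominates_speed:
  assumes "m > 0" "l > 0" "b \<ge> 0" "g > 0" "q1 > 0" "q2 > 0" "r > 0"
  obtains \<mu> where "0 < \<mu>" "\<And>z v. dist z (bottomright k) \<le> 1 \<Longrightarrow>
    \<mu> * norm (dynamics m l b g z v) \<le> running_cost q1 q2 r z v"
proof -
  define K where "K = 1 / (m * l\<^sup>2)"
  define A where "A = 1 + K * (b + m * g * l)"
  define \<mu> where "\<mu> = min (q1 / (A + K)) (r / K)"
  have K: "0 < K" using assms by (simp add: K_def)
  then have A: "0 < A" using assms by (simp add: A_def add_pos_nonneg)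
  have \<mu>: "0 < \<mu>" "\<mu> * (A + K) \<le> q1" "\<mu> * K \<le> r"
  proof -
    show "0 < \<mu>" using K A assms by (simp add: \<mu>_def)
    have "\<mu> \<le> q1 / (A + K)" "\<mu> \<le> r / K" by (simp_all add: \<mu>_def)
    then show "\<mu> * (A + K) \<le> q1" "\<mu> * K \<le> r" using K A by (simp_all add: pos_le_divide_eq)
  qed
  have "\<mu> * norm (dynamics m l b g (\<theta>, \<omega>) v) \<le> running_cost q1 q2 r (\<theta>, \<omega>) v"
    if near: "dist (\<theta>, \<omega>) (bottomright k) \<le> 1" for \<theta> \<omega> v
  proof -
    define s where "s = \<theta> - (pi + 2 * of_int k * pi)"
    have "\<bar>s\<bar> \<le> 1" "\<bar>\<omega>\<bar> \<le> 1"
      using near dist_fst_le[of "(\<theta>, \<omega>)" "bottomright k"] dist_snd_le[of "(\<theta>, \<omega>)" "bottomright k"]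
      by (auto simp: bottomright_def s_def dist_real_def)
    have "0 \<le> cos s" using \<open>\<bar>s\<bar> \<le> 1\<close> pi_gt3 by (intro cos_ge_zero) auto
    moreover have "cos \<theta> = - cos s"
    proof -
      have "\<theta> = (s + pi) + 2 * pi * of_int k" by (simp add: s_def)
      then show ?thesis using cos.plus_of_int[of "s + pi" k] by (simp add: mult.commute)
    qed
    ultimately have "1 \<le> (cos \<theta> - 1)\<^sup>2"
      using power_mono[of 1 "1 - cos \<theta>" 2] by (simp add: power2_commute)
    then have "q1 \<le> q1 * (cos \<theta> - 1)\<^sup>2" using assms by simp
    then have cost: "q1 + r * v\<^sup>2 \<le> running_cost q1 q2 r (\<theta>, \<omega>) v"
      using assms by (simp add: running_cost_def add_increasing add_increasing2)
    have "\<bar>b * \<omega> - m * g * l * sin \<theta> - v\<bar> \<le> \<bar>b * \<omega>\<bar> + \<bar>m * g * l * sin \<theta>\<bar> + \<bar>v\<bar>" by linarith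
    also have "\<dots> \<le> b + m * g * l + \<bar>v\<bar>"
      using assms \<open>\<bar>\<omega>\<bar> \<le> 1\<close>
      by (intro add_mono order_refl) (simp_all add: abs_mult mult_left_le)
    finally have acc: "\<bar>b * \<omega> - m * g * l * sin \<theta> - v\<bar> \<le> b + m * g * l + \<bar>v\<bar>" .
    have "norm (dynamics m l b g (\<theta>, \<omega>) v) \<le> \<bar>\<omega>\<bar> + K * \<bar>b * \<omega> - m * g * l * sin \<theta> - v\<bar>"
      using norm_Pair_le[of \<omega> "- K * (b * \<omega> - m * g * l * sin \<theta> - v)"] K
      using \<open>0 < m\<close> by (simp add: dynamics_def K_def abs_mult)
    also have "\<dots> \<le> 1 + K * (b + m * g * l + \<bar>v\<bar>)"
      using acc \<open>\<bar>\<omega>\<bar> \<le> 1\<close> K by (intro add_mono mult_left_mono) auto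
    also have "\<dots> = A + K * \<bar>v\<bar>" by (simp add: A_def algebra_simps)
    also have "\<dots> \<le> A + K * (1 + v\<^sup>2)"
    proof -
      have "0 \<le> (\<bar>v\<bar> - 1)\<^sup>2" by simp
      then have "\<bar>v\<bar> \<le> 1 + v\<^sup>2" by (simp add: power2_diff)
      then show ?thesis using K by simp
    qed
    finally have "\<mu> * norm (dynamics m l b g (\<theta>, \<omega>) v) \<le> \<mu> * (A + K * (1 + v\<^sup>2))"
      using \<mu>(1) by (intro mult_left_mono) auto
    also have "\<dots> = \<mu> * (A + K) + \<mu> * K * v\<^sup>2" by (simp add: algebra_simps)
    also have "\<dots> \<le> q1 + r * v\<^sup>2" using \<mu> by (intro add_mono mult_right_mono) auto
    finally show ?thesis using cost by simp
  qed
  then show thesis using that[of \<mu>] \<mu>(1) by auto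
qed

lemma sin_reflect_bottomright: "sin (2 * (pi + 2 * of_int k * pi) - \<theta>) = - sin \<theta>"
  and cos_reflect_bottomright: "cos (2 * (pi + 2 * of_int k * pi) - \<theta>) = cos \<theta>"
proof -
  have *: "2 * (pi + 2 * of_int k * pi) - \<theta> = - \<theta> + 2 * pi * of_int (1 + 2 * k)"
    by (simp add: algebra_simps)
  show "sin (2 * (pi + 2 * of_int k * pi) - \<theta>) = - sin \<theta>"
    unfolding * using sin.plus_of_int[of "- \<theta>" "1 + 2 * k"] by (simp add: mult.commute)
  show "cos (2 * (pi + 2 * of_int k * pi) - \<theta>) = cos \<theta>"
    unfolding * using cos.plus_of_int[of "- \<theta>" "1 + 2 * k"] by (simp add: mult.commute)
qed

lemma dynamics_reflect_bottomright:
  "dynamics m l b g (2 *\<^sub>R bottomright k - z) (- v) = - dynamics m l b g z v"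
proof (cases z)
  case (Pair \<theta> \<omega>)
  have "2 *\<^sub>R bottomright k - z = (2 * (pi + 2 * of_int k * pi) - \<theta>, - \<omega>)"
    by (simp add: bottomright_def Pair)
  then show ?thesis
    by (simp only: dynamics_def Pair prod.case sin_reflect_bottomright) (simp add: algebra_simps)
qed

lemma running_cost_reflect_bottomright:
  "running_cost q1 q2 r (2 *\<^sub>R bottomright k - z) (- v) = running_cost q1 q2 r z v"
proof (cases z)
  case (Pair \<theta> \<omega>)
  have "2 *\<^sub>R bottomright k - z = (2 * (pi + 2 * of_int k * pi) - \<theta>, - \<omega>)"
    by (simp add: bottomright_def Pair)
  then show ?thesis
    by (simp only: running_cost_def Pair prod.case sin_reflect_bottomright cos_reflect_bottomright)
      simp
qed

lemma upright_reflect_bottomright: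
  "2 *\<^sub>R bottomright k - upright j = upright (1 + 2 * k - j)"
  by (simp add: bottomright_def upright_def algebra_simps)

lemma upright_far_from_bottomright: "1 < dist (upright j) (bottomright k)"
proof -
  have "1 \<le> \<bar>2 * (j - k) - 1\<bar>" by presburger
  then have "1 \<le> \<bar>real_of_int (2 * (j - k) - 1)\<bar>" by linarith
  then have "pi \<le> \<bar>real_of_int (2 * (j - k) - 1)\<bar> * pi" using pi_gt_zero by simp
  also have "\<dots> = \<bar>real_of_int (2 * (j - k) - 1) * pi\<bar>" by (simp add: abs_mult)
  also have "\<dots> = dist (fst (upright j)) (fst (bottomright k))"
    by (simp add: upright_def bottomright_def dist_real_def algebra_simps)
  also have "\<dots> \<le> dist (upright j) (bottomright k)" by (rule dist_fst_le)
  finally show ?thesis using pi_gt3 by linarith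
qed

theorem theorem1:
  fixes m l b g q1 q2 r :: real and U :: "real set"
  assumes "m > 0" and "l > 0" and "b \<ge> 0" and "g > 0"
    and "q1 > 0" and "q2 > 0" and "r > 0"
    and "U = UNIV \<or> (\<exists>u_max. 0 < u_max \<and> u_max < m * g * l \<and> U = {- u_max..u_max})"
  shows "\<forall>k::int. \<not> C1_at (optimal_value (dynamics m l b g) (running_cost q1 q2 r) U) (bottomright k)"
proof (intro allI notI)
  fix k :: int
  let ?f = "dynamics m l b g" and ?c = "running_cost q1 q2 r" and ?a = "bottomright k"
  let ?V = "optimal_value ?f ?c U"
  assume "C1_at ?V ?a"
  then obtain N J' where N: "open N" "?a \<in> N" "\<forall>y\<in>N. ?V y < \<infinity>"
    and D: "((\<lambda>y. enn2real (?V y)) has_derivative blinfun_apply (J' ?a)) (at ?a)"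
    unfolding C1_at_def by blast
  have "enn2real (?V (2 *\<^sub>R ?a - y)) = enn2real (?V y)" for y
    using assms(8) by (intro arg_cong[where f = enn2real] optimal_value_reflect)
      (auto simp: dynamics_reflect_bottomright running_cost_reflect_bottomright
        upright_reflect_bottomright)
  then have "blinfun_apply (J' ?a) = (\<lambda>_. 0)"
    by (rule derivative_zero_at_centre_of_symmetry[OF D])
  with D have flat: "((\<lambda>y. enn2real (?V y)) has_derivative (\<lambda>_. 0)) (at ?a)" by simp
  obtain \<mu> where \<mu>: "0 < \<mu>" "\<And>z v. dist z ?a \<le> 1 \<Longrightarrow> \<mu> * norm (?f z v) \<le> ?c z v"
    using pendulum_cost_dominates_speed[OF assms(1-7)] by blast
  \<comment> \<open>A second torque value is always available, so a control can be made to jump at a restart.\<close>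
  have two: "\<exists>v\<in>U. v \<noteq> L" for L
    using assms(8)
  proof
    assume "U = UNIV"
    then show ?thesis by (intro bexI[of _ "L + 1"]) auto
  next
    assume "\<exists>u_max. 0 < u_max \<and> u_max < m * g * l \<and> U = {- u_max..u_max}"
    then obtain u_max where "0 < u_max" "U = {- u_max..u_max}" by blast
    then show ?thesis by (intro bexI[of _ "if L = 0 then u_max else 0"]) auto
  qed
  have cc: "continuous_on UNIV (\<lambda>(z, v). ?c z v)"
    unfolding running_cost_def case_prod_beta by (intro continuous_intros)
  have fin: "\<forall>\<^sub>F y in nhds ?a. ?V y < \<infinity>"
    using eventually_nhds_in_open[OF N(1,2)] by eventually_elim (use N(3) in blast)
  show False
    using value_not_flat_where_cost_dominates_speed[OF two cc \<mu>(1) zero_less_one \<mu>(2)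
        upright_far_from_bottomright fin] flat by contradiction
qed

end
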